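(* Let $P=(p_1,p_2,\ldots)$ be a sequence of prime numbers such that the set $S(P)$ is infinite. Then, for each $k\in\mathbb{N}$, the set of all periodic points of the limit mapping $h^k_P:\Sigma_P\to\Sigma_P$ is dense in $\Sigma_P$.
   Context: $\mathbb{N}$ is the set of positive integers; $1$ is not a prime. $\mathbb{S}^1$ is the unit circle in $\mathbb{C}$. For a sequence $P=(p_1,p_2,\ldots)$ of prime numbers, the $P$-adic solenoid is the inverse limit $\Sigma_P=\{(z_1,z_2,\ldots)\in\prod_{n\ge 1}\mathbb{S}^1 : z_{n+1}^{p_n}=z_n \text{ for all } n\in\mathbb{N}\}$ with the topology induced from the product topology. For $k\in\mathbb{N}$ the limit mapping $h^k_P:\Sigma_P\to\Sigma_P$ is $h^k_P((z_1,z_2,\ldots))=(z_1^k,z_2^k,\ldots)$. $S(P)$ denotes the set of all prime numbers which do not occur infinitely often in $P$, i.e. primes $q$ for which there is $m\in\mathbb{N}$ with $q\ne p_n$ for all $n\ge m$. A point $x\in X$ is periodic for a mapping $f:X\to X$ if there exists $n\in\mathbb{N}$ with $f^n(x)=x$, where $f^n$ is the $n$-th iterate of $f$. *)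

theory Defs
  imports "HOL-Analysis.Analysis" "HOL-Computational_Algebra.Primes"
begin

text \<open>
  Sequences are functions on \<^typ>\<open>nat\<close>, indexed from 0: \<open>P n\<close> stands for $p_{n+1}$ and
  \<open>z n\<close> for $z_{n+1}$.
\<close>

definition solenoid :: "(nat \<Rightarrow> nat) \<Rightarrow> (nat \<Rightarrow> complex) set" where
  "solenoid P = {z. (\<forall>n. z n \<in> sphere 0 1) \<and> (\<forall>n. z (Suc n) ^ P n = z n)}"

definition solenoid_topology :: "(nat \<Rightarrow> nat) \<Rightarrow> (nat \<Rightarrow> complex) topology" where
  "solenoid_topology P =
     subtopology (product_topology (\<lambda>n::nat. top_of_set (sphere (0::complex) 1)) UNIV) (solenoid P)"

text \<open>
  The map is a total function on sequences; only its values on the solenoid matter, which it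
  maps to itself by \<open>limit_map_in_solenoid\<close> below.
\<close>

definition limit_map :: "nat \<Rightarrow> (nat \<Rightarrow> complex) \<Rightarrow> (nat \<Rightarrow> complex)" where
  "limit_map k z = (\<lambda>n. z n ^ k)"

definition primes_not_infinitely_often :: "(nat \<Rightarrow> nat) \<Rightarrow> nat set" where
  "primes_not_infinitely_often P = {q. prime q \<and> (\<exists>m. \<forall>n\<ge>m. q \<noteq> P n)}"

definition periodic_points :: "'a set \<Rightarrow> ('a \<Rightarrow> 'a) \<Rightarrow> 'a set" where
  "periodic_points X f = {x \<in> X. \<exists>n\<ge>1. (f ^^ n) x = x}"

definition dense_in_topology :: "'a topology \<Rightarrow> 'a set \<Rightarrow> bool" where
  "dense_in_topology T A \<longleftrightarrow> A \<subseteq> topspace T \<and> T closure_of A = topspace T"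

lemma topspace_solenoid_topology: "topspace (solenoid_topology P) = solenoid P"
  by (auto simp: solenoid_topology_def solenoid_def)

lemma limit_map_in_solenoid:
  assumes "z \<in> solenoid P"
  shows "limit_map k z \<in> solenoid P"
proof -
  have "(z (Suc n) ^ k) ^ P n = z n ^ k" for n
  proof -
    have "(z (Suc n) ^ k) ^ P n = (z (Suc n) ^ P n) ^ k"
      by (simp add: power_mult [symmetric] mult.commute)
    then show ?thesis using assms by (simp add: solenoid_def)
  qed
  then show ?thesis
    using assms by (simp add: solenoid_def limit_map_def norm_power)
qed

end

theory Submission
  imports Defs "HOL-Number_Theory.Residues"
begin

text \<open>
  Fix a point \<open>w\<close> of the solenoid and a prime \<open>q\<close> that does not divide \<open>k\<close> and does not occur
  in \<open>P\<close> from position \<open>m\<close> on. Finitely many coordinates of \<open>w\<close> are powers of a single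
  coordinate \<open>w M\<close> with \<open>M \<ge> m\<close>, so it suffices to approximate \<open>w M\<close>. The roots of unity of
  order a power of \<open>q\<close> are dense in the circle, and any such root extends to a point of the
  solenoid because raising to the power \<open>P n\<close>, for \<open>n \<ge> M\<close>, permutes the \<open>q ^ r\<close>-th roots of
  unity. By Euler's theorem all points obtained in this way are periodic. Only after \<open>M\<close>, hence
  \<open>q\<close>, has been chosen is the exponent \<open>r\<close> taken large.
\<close>

lemma power_eq_of_cong:
  fixes x :: "'a::monoid_mult"
  assumes "x ^ m = 1" "[a = b] (mod m)"
  shows "x ^ a = x ^ b"
proof -
  have "x ^ c = x ^ (c mod m)" for c
  proof -
    have "x ^ c = x ^ (m * (c div m) + c mod m)" by simp
    also have "\<dots> = x ^ (c mod m)"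
      by (simp only: power_add power_mult assms(1)) simp
    finally show ?thesis .
  qed
  then show ?thesis using assms(2) by (metis cong_def)
qed

text \<open>Rounding down costs less than 1 in the numerator, hence at most \<open>1 / c ^ r\<close>
  in the quotient, which tends to 0 since \<open>c > 1\<close>.\<close>

lemma tendsto_floor_mult_power_divide:
  fixes x c :: real
  assumes "c > 1"
  shows "(\<lambda>r. of_int \<lfloor>x * c ^ r\<rfloor> / c ^ r) \<longlonglongrightarrow> x"
proof -
  have "(\<lambda>r. of_int \<lfloor>x * c ^ r\<rfloor> / c ^ r - x) \<longlonglongrightarrow> 0"
  proof (rule Lim_null_comparison)
    show "\<forall>\<^sub>F r in sequentially. norm (of_int \<lfloor>x * c ^ r\<rfloor> / c ^ r - x) \<le> inverse c ^ r"
    proof (rule always_eventually, intro allI)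
      fix r
      have "c ^ r > 0" using assms by simp
      then have "of_int \<lfloor>x * c ^ r\<rfloor> / c ^ r - x = (of_int \<lfloor>x * c ^ r\<rfloor> - x * c ^ r) / c ^ r"
        using assms by (simp add: diff_divide_distrib)
      then have "norm (of_int \<lfloor>x * c ^ r\<rfloor> / c ^ r - x)
          = \<bar>of_int \<lfloor>x * c ^ r\<rfloor> - x * c ^ r\<bar> / c ^ r"
        using \<open>c ^ r > 0\<close> by (simp only: real_norm_def abs_divide abs_of_pos)
      also have "\<dots> \<le> 1 / c ^ r"
        using \<open>c ^ r > 0\<close> by (intro divide_right_mono) linarith+
      finally show "norm (of_int \<lfloor>x * c ^ r\<rfloor> / c ^ r - x) \<le> inverse c ^ r"
        by (simp add: inverse_eq_divide power_one_over)
    qed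
    show "(\<lambda>r. inverse c ^ r) \<longlonglongrightarrow> 0"
      using assms by (intro LIMSEQ_power_zero) (simp add: inverse_less_1_iff)
  qed
  then show ?thesis by (simp add: LIM_zero_iff)
qed

text \<open>Write \<open>w\<close> as \<open>cis (2 * pi * t)\<close> and approximate
  \<open>t\<close> by fractions with denominator \<open>q ^ r\<close>; continuity of the exponential
  carries the convergence over to the circle.\<close>

lemma tendsto_roots_of_unity:
  fixes w :: complex and q :: nat
  assumes "norm w = 1" "q > 1"
  obtains \<xi> where "\<And>r. \<xi> r ^ (q ^ r) = 1" "\<xi> \<longlonglongrightarrow> w"
proof -
  obtain t where t: "w = cis (2 * pi * t)"
  proof
    show "w = cis (2 * pi * (Arg w / (2 * pi)))"
      using assms(1) cis_Arg[of w] by (cases "w = 0") (auto simp: sgn_div_norm)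
  qed
  let ?a = "\<lambda>r. of_int \<lfloor>t * real q ^ r\<rfloor> / real q ^ r"
  have "cis (2 * pi * ?a r) ^ (q ^ r) = 1" for r
  proof -
    have "real (q ^ r) * (2 * pi * ?a r) = 2 * pi * of_int \<lfloor>t * real q ^ r\<rfloor>"
      using assms(2) by simp
    then show ?thesis by (simp only: Complex.DeMoivre cis_multiple_2pi Ints_of_int)
  qed
  moreover have "(\<lambda>r. cis (2 * pi * ?a r)) \<longlonglongrightarrow> cis (2 * pi * t)"
    unfolding cis_conv_exp using assms(2)
    by (intro tendsto_intros tendsto_floor_mult_power_divide) simp
  ultimately show thesis using that[of "\<lambda>r. cis (2 * pi * ?a r)"] t by simp
qed

lemma solenoid_coordinate_eq_power:
  assumes "z \<in> solenoid P" "n \<le> m"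
  shows "z n = z m ^ (\<Prod>i\<in>{n..<m}. P i)"
  using assms(2)
proof (induction m rule: dec_induct)
  case (step j)
  have "z j = z (Suc j) ^ P j" using assms(1) by (simp add: solenoid_def)
  then show ?case
    using step by (simp add: power_mult [symmetric] mult.commute)
qed simp

text \<open>Coordinates before \<open>m\<close> are forced to be powers of \<open>x\<close>. After
  \<open>m\<close>, a root for the exponent \<open>P n\<close> is found among the
  \<open>Q\<close>-th roots of unity by raising to an inverse \<open>I n\<close> of
  \<open>P n\<close> modulo \<open>Q\<close>.\<close>

lemma solenoid_extend_root_of_unity:
  assumes "x ^ Q = 1" "Q > 0" "\<And>n. n \<ge> m \<Longrightarrow> coprime (P n) Q"
  obtains z where "z \<in> solenoid P" "z m = x" "\<And>n. z n ^ Q = 1"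
proof -
  have "\<exists>I. [P n * I = 1] (mod Q)" if "n \<ge> m" for n
    using cong_solve_coprime_nat[OF assms(3)[OF that]] by simp
  then obtain I where I: "\<And>n. n \<ge> m \<Longrightarrow> [P n * I n = 1] (mod Q)" by metis
  \<comment> \<open>At most one of the two products is nonempty: the first for \<open>n < m\<close>,
    the second for \<open>n > m\<close>. Both are 1 at \<open>n = m\<close>.\<close>
  define z where "z n = x ^ ((\<Prod>i\<in>{n..<m}. P i) * (\<Prod>i\<in>{m..<n}. I i))" for n
  have roots: "z n ^ Q = 1" for n
    unfolding z_def using assms(1) by (metis power_mult mult.commute power_one)
  have "z (Suc n) ^ P n = z n" for n
  proof (cases "n < m")
    case True
    then show ?thesis
      by (simp add: z_def prod.atLeast_Suc_lessThan[of n m] power_mult [symmetric] mult.commute)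
  next
    case False
    then have "z (Suc n) ^ P n = z n ^ (P n * I n)"
      by (simp add: z_def power_mult [symmetric] ac_simps)
    also have "\<dots> = z n ^ 1"
      using False I by (intro power_eq_of_cong[OF roots]) simp
    finally show ?thesis by simp
  qed
  moreover have "norm (z n) = 1" for n
    using roots[of n] assms(2) power_eq_1_iff by blast
  ultimately have "z \<in> solenoid P" by (simp add: solenoid_def)
  moreover have "z m = x" by (simp add: z_def)
  ultimately show thesis using that roots by blast
qed

lemma funpow_limit_map: "(limit_map k ^^ t) z n = z n ^ (k ^ t)"
  by (induction t arbitrary: n) (simp_all add: limit_map_def power_mult [symmetric] mult.commute)

text \<open>Exponents matter only modulo \<open>Q\<close>, and \<open>k ^ totient Q\<close> is 1
  modulo \<open>Q\<close>, so \<open>totient Q\<close> is a period common to all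
  coordinates.\<close>

lemma periodic_point_limit_map:
  assumes "z \<in> solenoid P" "\<And>n. z n ^ Q = 1" "Q > 0" "coprime k Q"
  shows "z \<in> periodic_points (solenoid P) (limit_map k)"
proof -
  have "(limit_map k ^^ totient Q) z n = z n" for n
    using power_eq_of_cong[OF assms(2) euler_theorem[OF assms(4)], of n]
    by (simp add: funpow_limit_map)
  then have "(limit_map k ^^ totient Q) z = z" by blast
  moreover have "totient Q \<ge> 1" using assms(3) by (simp add: Suc_le_eq)
  ultimately show ?thesis using assms(1) by (auto simp: periodic_points_def)
qed

theorem proposition6:
  fixes P :: "nat \<Rightarrow> nat" and k :: nat
  assumes "\<And>n. prime (P n)"
    and "infinite (primes_not_infinitely_often P)"
    and "k \<ge> 1"
  shows "dense_in_topology (solenoid_topology P) (periodic_points (solenoid P) (limit_map k))"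
proof -
  \<comment> \<open>Infinitude of the set gives a prime above \<open>k\<close>, which cannot divide
    \<open>k\<close> because \<open>k\<close> is positive.\<close>
  obtain q where q: "q \<in> primes_not_infinitely_often P" "q > k"
    using assms(2) by (meson infinite_nat_iff_unbounded)
  then obtain m where "prime q" and m: "\<And>n. n \<ge> m \<Longrightarrow> q \<noteq> P n"
    by (auto simp: primes_not_infinitely_often_def)
  have "q > 1" using \<open>prime q\<close> by (rule prime_gt_1_nat)
  have "coprime q k"
    using \<open>prime q\<close> q(2) assms(3) by (intro prime_imp_coprime) (auto dest: dvd_imp_le)
  then have cop_k: "coprime k (q ^ r)" for r by (simp add: coprime_commute)
  have cop_P: "coprime (P n) (q ^ r)" if "n \<ge> m" for n r
    using primes_coprime[OF assms(1) \<open>prime q\<close>] m[OF that] by auto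
  have "\<exists>z \<in> periodic_points (solenoid P) (limit_map k). z \<in> T"
    if w: "w \<in> solenoid P" and T: "w \<in> T" "openin (solenoid_topology P) T" for w T
  proof -
    obtain S where S: "openin (product_topology (\<lambda>n. top_of_set (sphere (0::complex) 1)) UNIV) S"
      "T = S \<inter> solenoid P"
      using T(2) by (auto simp: solenoid_topology_def openin_subtopology)
    then obtain U where U: "finite {i. U i \<noteq> sphere (0::complex) 1}"
      "\<And>i. openin (top_of_set (sphere (0::complex) 1)) (U i)" "\<And>i. w i \<in> U i" "Pi UNIV U \<subseteq> S"
      using T(1) by (force simp: openin_product_topology_alt PiE_UNIV_domain)
    define F where "F = {i. U i \<noteq> sphere (0::complex) 1}"
    \<comment> \<open>\<open>M\<close> bounds the finitely many restricted coordinates and lies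
      beyond the last occurrence of \<open>q\<close> in \<open>P\<close>.\<close>
    obtain M where M: "M \<ge> m" "\<And>i. i \<in> F \<Longrightarrow> i \<le> M"
      using U(1) finite_nat_set_iff_bounded_le[of F] unfolding F_def
      by (metis le_trans max.cobounded1 max.cobounded2)
    \<comment> \<open>Sets open in the plane allow the convergence of \<open>\<xi>\<close> in the
      complex numbers to be used directly.\<close>
    obtain V where V: "\<And>i. open (V i)" "\<And>i. U i = sphere 0 1 \<inter> V i"
      using U(2) unfolding openin_open by metis
    have "norm (w M) = 1" using w by (auto simp: solenoid_def)
    then obtain \<xi> where \<xi>: "\<And>r. \<xi> r ^ (q ^ r) = 1" "\<xi> \<longlonglongrightarrow> w M"
      using tendsto_roots_of_unity \<open>q > 1\<close> by metis
    \<comment> \<open>The power shown is the \<open>i\<close>-th coordinate of any solenoid point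
      whose coordinate at \<open>M\<close> is \<open>\<xi> r\<close>. Finiteness of \<open>F\<close>
      lets one \<open>r\<close> serve all \<open>i\<close>.\<close>
    have "\<forall>\<^sub>F r in sequentially. \<forall>i\<in>F. \<xi> r ^ (\<Prod>j\<in>{i..<M}. P j) \<in> V i"
    proof (rule eventually_ball_finite)
      show "finite F" using U(1) by (simp add: F_def)
      show "\<forall>i\<in>F. \<forall>\<^sub>F r in sequentially. \<xi> r ^ (\<Prod>j\<in>{i..<M}. P j) \<in> V i"
      proof
        fix i assume "i \<in> F"
        have "w i \<in> V i" using U(3) V(2) by blast
        then have "w M ^ (\<Prod>j\<in>{i..<M}. P j) \<in> V i"
          using solenoid_coordinate_eq_power[OF w M(2)[OF \<open>i \<in> F\<close>]] by simp
        then show "\<forall>\<^sub>F r in sequentially. \<xi> r ^ (\<Prod>j\<in>{i..<M}. P j) \<in> V i"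
          using topological_tendstoD[OF tendsto_power[OF \<xi>(2)] V(1)] by blast
      qed
    qed
    then obtain r where r: "\<And>i. i \<in> F \<Longrightarrow> \<xi> r ^ (\<Prod>j\<in>{i..<M}. P j) \<in> V i"
      by (auto simp: eventually_sequentially)
    have "q ^ r > 0" using \<open>q > 1\<close> by simp
    then obtain z where z: "z \<in> solenoid P" "z M = \<xi> r" "\<And>n. z n ^ (q ^ r) = 1"
      using solenoid_extend_root_of_unity[OF \<xi>(1), of r M P] cop_P M(1) le_trans by metis
    have "z i \<in> U i" for i
    proof (cases "i \<in> F")
      case True
      then have "z i \<in> V i"
        using solenoid_coordinate_eq_power[OF z(1) M(2)] r z(2) by simp
      then show ?thesis using V(2) z(1) by (simp add: solenoid_def)
    next
      case False
      then show ?thesis using z(1) by (simp add: F_def solenoid_def)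
    qed
    then have "z \<in> T" using U(4) S(2) z(1) by blast
    then show ?thesis
      using periodic_point_limit_map[OF z(1,3) \<open>q ^ r > 0\<close> cop_k] by blast
  qed
  then show ?thesis
    unfolding dense_in_topology_def topspace_solenoid_topology
    by (auto simp: in_closure_of topspace_solenoid_topology periodic_points_def)
qed

end
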